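(* Let $t(i,j)$ be the number of simple $(i,j)$-protocols, and let $\zeta$, $C_1$, $C_2$ be the constants defined in the context. Fix an integer $k\ge 0$. Then for integers $i\ge j\ge 1$ with $i-j=k$: a) $$t(i,j)=C_1\left|\binom{-1/2}{2i-j+1}\right|\zeta^{-(i+j)/2}+O\!\left(\zeta^{-j}j^{-3/2}\right),$$ with an implied constant that depends on $k$; b) $$t(i,j)\sim \frac{C_2\,\zeta^{-(i+j)/2}}{\sqrt{2i-j+1}}\qquad (j\to\infty,\ i-j=k \text{ fixed}),$$ i.e. the ratio of the two sides tends to $1$.
   Context: For integers $i,j\ge 0$, a simple $(i,j)$-protocol is a finite string of symbols, each equal to $[A]$, $[B]$ or $[AB]$, in which no $[A]$ is immediately followed by $[A]$, no $[B]$ is immediately followed by $[B]$, the number of $[A]$'s plus the number of $[AB]$'s is $i$, and the number of $[B]$'s plus the number of $[AB]$'s is $j$. $t(i,j)$ is the number of simple $(i,j)$-protocols. $\zeta\approx 0.296$ is the root closest to the origin of $Q=1-4y+2y^2+y^4=(1-y)(1-3y-y^2-y^3)$ (so $\zeta^{-1}\approx 3.383$). $$C_1=\frac{1-\zeta}{2\zeta^2\sqrt{2+\zeta}}\approx 2.660,\qquad C_2=\frac{C_1}{\sqrt{\pi}}\approx 1.501.$$ $\binom{-1/2}{n}$ is the generalized binomial coefficient. *)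

theory Defs
  imports
    "HOL-Analysis.Analysis"
    "HOL-Library.Landau_Symbols"
    "HOL-Computational_Algebra.Polynomial"
begin

datatype protocol_symbol = Sym_A | Sym_B | Sym_AB

definition simple_protocol :: "nat \<Rightarrow> nat \<Rightarrow> protocol_symbol list \<Rightarrow> bool" where
  "simple_protocol i j w \<longleftrightarrow>
     successively (\<lambda>x y. \<not> (x = Sym_A \<and> y = Sym_A) \<and> \<not> (x = Sym_B \<and> y = Sym_B)) w \<and>
     count_list w Sym_A + count_list w Sym_AB = i \<and>
     count_list w Sym_B + count_list w Sym_AB = j"

definition num_protocols :: "nat \<Rightarrow> nat \<Rightarrow> nat" where
  "num_protocols i j = card {w. simple_protocol i j w}"

text \<open>The set counted above is finite, so the cardinality is the intended one.\<close>

lemma finite_simple_protocols: "finite {w. simple_protocol i j w}"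
proof (rule finite_subset)
  have "length w \<le> i + j" if "simple_protocol i j w" for w
  proof -
    have "length w = count_list w Sym_A + count_list w Sym_B + count_list w Sym_AB"
    proof (induction w)
      case (Cons x w)
      then show ?case by (cases x) auto
    qed simp
    with that show ?thesis by (simp add: simple_protocol_def)
  qed
  moreover have "set w \<subseteq> {Sym_A, Sym_B, Sym_AB}" for w
    by (auto intro: protocol_symbol.exhaust)
  ultimately show "{w. simple_protocol i j w} \<subseteq>
      {w. set w \<subseteq> {Sym_A, Sym_B, Sym_AB} \<and> length w \<le> i + j}"
    by blast
  show "finite {w. set w \<subseteq> {Sym_A, Sym_B, Sym_AB} \<and> length w \<le> i + j}"
    by (rule finite_lists_length_le) simp
qed

definition Q_poly :: "complex poly" where
  "Q_poly = [:1, -4, 2, 0, 1:]"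

text \<open>
  The root of least modulus among all complex roots; it is unique and real (lemma below),
  and is introduced as a real number so that the constants and real powers can use it.
\<close>

definition zeta :: real where
  "zeta = (THE x. poly Q_poly (complex_of_real x) = 0 \<and>
     (\<forall>z. poly Q_poly z = 0 \<and> z \<noteq> complex_of_real x \<longrightarrow>
          cmod (complex_of_real x) < cmod z))"

lemma poly_Q_factored: "poly Q_poly z = (1 - z) * (1 - 3 * z - z ^ 2 - z ^ 3)"
  by (simp add: Q_poly_def algebra_simps power2_eq_square power3_eq_cube)

lemma zeta_well_defined:
  "\<exists>!x. poly Q_poly (complex_of_real x) = 0 \<and>
     (\<forall>z. poly Q_poly z = 0 \<and> z \<noteq> complex_of_real x \<longrightarrow>
          cmod (complex_of_real x) < cmod z)" (is "\<exists>!x. ?P x")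
proof -
  have "\<exists>x\<ge>29/100. x \<le> 3/10 \<and> 3 * x + x ^ 2 + x ^ 3 = (1::real)"
    by (rule IVT') (auto intro!: continuous_intros simp: power2_eq_square power3_eq_cube)
  then obtain r :: real where r: "r \<ge> 29/100" "r \<le> 3/10" "3 * r + r ^ 2 + r ^ 3 = 1"
    by blast
  have "of_real (3 * r + r ^ 2 + r ^ 3) = (1 :: complex)"
    by (simp only: r(3) of_real_1)
  then have root: "poly Q_poly (of_real r) = 0"
    unfolding poly_Q_factored by (simp add: algebra_simps)
  have least: "cmod (of_real r) < cmod z" if z: "poly Q_poly z = 0" "z \<noteq> of_real r" for z
  proof (rule ccontr)
    assume "\<not> ?thesis"
    then have le: "cmod z \<le> r" using r by simp
    then have "z \<noteq> 1" using r by auto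
    with z(1) have "1 - 3 * z - z ^ 2 - z ^ 3 = 0"
      unfolding poly_Q_factored by simp
    then have eq: "3 * z + z ^ 2 + z ^ 3 = 1"
      by (simp add: algebra_simps)
    have "1 = 3 * Re z + Re (z ^ 2) + Re (z ^ 3)"
      using arg_cong[OF eq, of Re] by simp
    moreover have "Re (z ^ 2) \<le> r ^ 2" "Re (z ^ 3) \<le> r ^ 3"
      using complex_Re_le_cmod[of "z ^ 2"] complex_Re_le_cmod[of "z ^ 3"]
        power_mono[OF le norm_ge_zero, of 2] power_mono[OF le norm_ge_zero, of 3]
      unfolding norm_power by linarith+
    ultimately have "r \<le> Re z" using r(3) by linarith
    with le have "Re z = r" "cmod z = Re z"
      using complex_Re_le_cmod[of z] by linarith+
    then have "z = of_real r"
      by (smt (verit) cmod_power2 complex_eq_iff Re_complex_of_real Im_complex_of_real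
          zero_eq_power2)
    with z(2) show False by contradiction
  qed
  show ?thesis
  proof (rule ex1I[of _ r])
    show "?P r" using root least by blast
  next
    fix x assume "?P x"
    then show "x = r"
      using root least by (metis less_asym of_real_eq_iff)
  qed
qed

definition C1 :: real where
  "C1 = (1 - zeta) / (2 * zeta ^ 2 * sqrt (2 + zeta))"

definition C2 :: real where
  "C2 = C1 / sqrt pi"

end

theory Submission
  imports Defs "HOL-Computational_Algebra.Polynomial_FPS"
begin

text \<open>
  Decomposing protocols by their first symbol gives
  t(i,j) = 2 t(i-1,j-1) + t(i-2,j-1) + t(i-1,j-2) + t(i-2,j-2) off the boundary. Let d(k) be the
  generating function of the diagonal t(j+k,j). With D = 1 - 2w - w^2 one has Q = D^2 - 4w^3, and the
  recurrence, a linear system for the d(k), is solved by w d(k) = rho^k (1 - w) Q^(-1/2) (plus 1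
  on the left if k = 0), where 2 w^2 rho = D - Q^(1/2). Expanding (D - Q^(1/2))^k shows that
  2^k t(j+k,j) is, up to finitely many j, the coefficient of w^(j+2k+1) in
  (1 - w) P(w) Q^(-1/2) for a polynomial P with P(zeta) = D(zeta)^k; this is the origin of the
  index 2i - j + 1.

  Singularity analysis at zeta needs only real series: Q = (1 - w / zeta) (1 - u), where u is a
  polynomial with nonnegative coefficients and u(1) = 1. Hence the coefficients of (1 - u)^(-1/2)
  lie in [0,1], and (1 - w) P (1 - u)^(-1/2) converges beyond zeta. Replacing this factor of
  (1 - w / zeta)^(-1/2) by its value at zeta leaves (1 - w / zeta)^(1/2) times a series that
  converges beyond zeta, whose coefficients are O(zeta^(-n) n^(-3/2)).
\<close>

unbundle no vec_syntax
unbundle fps_syntax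

section \<open>Counting protocols\<close>

definition num_starting :: "protocol_symbol \<Rightarrow> nat \<Rightarrow> nat \<Rightarrow> nat" where
  "num_starting s i j = card {w. simple_protocol i j w \<and> w \<noteq> [] \<and> hd w = s}"

lemma simple_protocol_Nil: "simple_protocol i j [] \<longleftrightarrow> i = 0 \<and> j = 0"
  by (auto simp: simple_protocol_def)

text \<open>In the first two cases the tail may be empty or begin with a different symbol; a leading
  \<open>Sym_AB\<close> constrains nothing.\<close>

lemma simple_protocol_Cons:
  "simple_protocol i j (Sym_A # w) \<longleftrightarrow>
     (\<exists>i'. i = Suc i' \<and> simple_protocol i' j w \<and> \<not> (w \<noteq> [] \<and> hd w = Sym_A))"
  "simple_protocol i j (Sym_B # w) \<longleftrightarrow>
     (\<exists>j'. j = Suc j' \<and> simple_protocol i j' w \<and> \<not> (w \<noteq> [] \<and> hd w = Sym_B))"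
  "simple_protocol i j (Sym_AB # w) \<longleftrightarrow>
     (\<exists>i' j'. i = Suc i' \<and> j = Suc j' \<and> simple_protocol i' j' w)"
  by (auto simp: simple_protocol_def successively_Cons)

lemma finite_simple_protocols': "finite {w. simple_protocol i j w \<and> P w}"
  by (rule finite_subset[OF _ finite_simple_protocols[of i j]]) auto

lemma num_not_starting:
  "card {w. simple_protocol i j w \<and> \<not> (w \<noteq> [] \<and> hd w = s)} + num_starting s i j
     = num_protocols i j"
  (is "card ?N + _ = _")
proof -
  let ?S = "{w. simple_protocol i j w \<and> w \<noteq> [] \<and> hd w = s}"
  have "card (?N \<union> ?S) = card ?N + card ?S"
    by (rule card_Un_disjoint[OF finite_simple_protocols' finite_simple_protocols']) blast
  moreover have "?N \<union> ?S = {w. simple_protocol i j w}"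
    by blast
  ultimately show ?thesis
    unfolding num_protocols_def num_starting_def by metis
qed

lemma num_protocols_split:
  "num_protocols i j = num_starting Sym_A i j + num_starting Sym_B i j + num_starting Sym_AB i j
     + (if i = 0 \<and> j = 0 then 1 else 0)"
proof -
  let ?S = "\<lambda>s. {w. simple_protocol i j w \<and> w \<noteq> [] \<and> hd w = s}"
  let ?E = "{w. simple_protocol i j w \<and> w = []}"
  have fin: "finite {w. simple_protocol i j w \<and> P w}" for P
    by (rule finite_simple_protocols')
  have 1: "card (?S Sym_A \<union> ?S Sym_B) = card (?S Sym_A) + card (?S Sym_B)"
    by (rule card_Un_disjoint[OF fin fin]) auto
  have 2: "card (?S Sym_A \<union> ?S Sym_B \<union> ?S Sym_AB)
      = card (?S Sym_A \<union> ?S Sym_B) + card (?S Sym_AB)"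
    by (rule card_Un_disjoint[OF finite_UnI[OF fin fin] fin]) auto
  have 3: "card (?S Sym_A \<union> ?S Sym_B \<union> ?S Sym_AB \<union> ?E)
      = card (?S Sym_A \<union> ?S Sym_B \<union> ?S Sym_AB) + card ?E"
    by (rule card_Un_disjoint[OF finite_UnI[OF finite_UnI[OF fin fin] fin] fin]) auto
  have 4: "{w. simple_protocol i j w} = ?S Sym_A \<union> ?S Sym_B \<union> ?S Sym_AB \<union> ?E"
    using protocol_symbol.exhaust by blast
  have 5: "?E = (if i = 0 \<and> j = 0 then {[]} else {})"
    by (auto simp: simple_protocol_Nil)
  have "card ?E = (if i = 0 \<and> j = 0 then 1 else 0)"
    unfolding 5 by simp
  then show ?thesis
    using 1 2 3 unfolding num_protocols_def num_starting_def 4 by linarith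
qed

lemma Collect_starting:
  "{w. P w \<and> w \<noteq> [] \<and> hd w = s} = (#) s ` {w. P (s # w)}"
  by (auto simp: image_iff neq_Nil_conv)

text \<open>Deleting the leading \<open>Sym_A\<close> leaves an arbitrary protocol that does not
  itself begin with \<open>Sym_A\<close>, and \<open>num_not_starting\<close> counts those. The sum
  form avoids subtraction of natural numbers.\<close>

lemma num_starting_A:
  "num_starting Sym_A 0 j = 0"
  "num_starting Sym_A (Suc i) j + num_starting Sym_A i j = num_protocols i j"
  using num_not_starting[of i j Sym_A]
  by (simp_all add: num_starting_def[of _ 0] num_starting_def[of _ "Suc _"] Collect_starting
      card_image simple_protocol_Cons del: not_not de_Morgan_conj)

lemma num_starting_B:
  "num_starting Sym_B i 0 = 0"
  "num_starting Sym_B i (Suc j) + num_starting Sym_B i j = num_protocols i j"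
  using num_not_starting[of i j Sym_B]
  by (simp_all add: num_starting_def[of _ _ 0] num_starting_def[of _ _ "Suc _"] Collect_starting
      card_image simple_protocol_Cons del: not_not de_Morgan_conj)

lemma num_starting_AB:
  "num_starting Sym_AB i 0 = 0"
  "num_starting Sym_AB 0 j = 0"
  "num_starting Sym_AB (Suc i) (Suc j) = num_protocols i j"
  by (simp_all add: num_starting_def Collect_starting card_image simple_protocol_Cons
      num_protocols_def)

lemma num_starting_A_Suc_0: "num_starting Sym_A (Suc i) 0 = (if i = 0 then 1 else 0)"
proof -
  note [simp] = num_starting_A(1) num_starting_B(1) num_starting_AB(1)
  show ?thesis
  proof (cases i)
    case (Suc i')
    then show ?thesis
      using num_starting_A(2)[of "Suc i'" 0] num_protocols_split[of "Suc i'" 0] by simp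
  qed (use num_starting_A(2)[of 0 0] num_protocols_split[of 0 0] in simp)
qed

lemma num_starting_B_Suc_0: "num_starting Sym_B 0 (Suc j) = (if j = 0 then 1 else 0)"
proof -
  note [simp] = num_starting_A(1) num_starting_B(1) num_starting_AB(2)
  show ?thesis
  proof (cases j)
    case (Suc j')
    then show ?thesis
      using num_starting_B(2)[of 0 "Suc j'"] num_protocols_split[of 0 "Suc j'"] by simp
  qed (use num_starting_B(2)[of 0 0] num_protocols_split[of 0 0] in simp)
qed

lemma num_protocols_0_right: "num_protocols i 0 = (if i \<le> 1 then 1 else 0)"
  using num_starting_A_Suc_0[of "i - 1"] num_protocols_split[of i 0]
  by (cases i) (auto simp: num_starting_A(1) num_starting_B(1) num_starting_AB(1))

lemma num_protocols_0_left: "num_protocols 0 j = (if j \<le> 1 then 1 else 0)"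
  using num_starting_B_Suc_0[of "j - 1"] num_protocols_split[of 0 j]
  by (cases j) (auto simp: num_starting_A(1) num_starting_B(1) num_starting_AB(2))

text \<open>Adding the first-symbol splits at the four corners of a unit square pairs the counts
  starting with \<open>Sym_A\<close> along i and those starting with \<open>Sym_B\<close> along j.
  Each pair is a protocol count, so only the \<open>Sym_AB\<close> terms survive.\<close>

lemma num_protocols_rec_AB:
  "num_protocols (Suc i) (Suc j) + num_protocols i j
    = 2 * num_protocols i j + num_starting Sym_AB (Suc i) (Suc j) + num_starting Sym_AB i (Suc j)
      + num_starting Sym_AB (Suc i) j + num_starting Sym_AB i j + of_bool (i = 0 \<and> j = 0)"
  using num_protocols_split[of "Suc i" "Suc j"] num_protocols_split[of "Suc i" j]
    num_protocols_split[of i "Suc j"] num_protocols_split[of i j]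
    num_starting_A(2)[of i "Suc j"] num_starting_A(2)[of i j]
    num_starting_B(2)[of "Suc i" j] num_starting_B(2)[of i j]
  by simp

lemma num_protocols_rec:
  "num_protocols (Suc 0) (Suc 0) = 3"
  "num_protocols (Suc (Suc i)) (Suc 0) = 2 * num_protocols (Suc i) 0 + num_protocols i 0"
  "num_protocols (Suc (Suc i)) (Suc (Suc j)) = 2 * num_protocols (Suc i) (Suc j)
     + num_protocols i (Suc j) + num_protocols (Suc i) j + num_protocols i j"
  subgoal using num_protocols_rec_AB[of 0 0] by (simp add: num_starting_AB num_protocols_0_right)
  subgoal using num_protocols_rec_AB[of "Suc i" 0] by (simp add: num_starting_AB)
  subgoal using num_protocols_rec_AB[of "Suc i" "Suc j"] by (simp add: num_starting_AB)
  done

lemma num_protocols_rec':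
  "num_protocols (Suc 0) (Suc (Suc j)) = 2 * num_protocols 0 (Suc j) + num_protocols 0 j"
  using num_protocols_rec_AB[of 0 "Suc j"]
  by (simp add: num_starting_AB num_protocols_0_left)

text \<open>Both the recurrence and the boundary values are symmetric. This lets the system for the
  diagonals close at offset 0.\<close>

lemma num_protocols_commute: "num_protocols i j = num_protocols j i"
proof (induction "i + j" arbitrary: i j rule: less_induct)
  case less
  consider "i \<le> 1 \<or> j \<le> 1" | i' j' where "i = Suc (Suc i')" "j = Suc (Suc j')"
    by (metis One_nat_def Suc_le_mono le0 not0_implies_Suc)
  then show ?case
  proof cases
    case 1
    have "n = 0 \<or> n = Suc 0 \<or> (\<exists>m. n = Suc (Suc m))" for n
      by (metis not0_implies_Suc)
    from this[of i] this[of j] 1 show ?thesis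
      by (auto simp: num_protocols_0_left num_protocols_0_right num_protocols_rec
          num_protocols_rec')
  next
    case 2
    then show ?thesis
      using less[of "Suc i'" "Suc j'"] less[of i' "Suc j'"] less[of "Suc i'" j'] less[of i' j']
      by (simp add: num_protocols_rec)
  qed
qed

section \<open>Coefficients of inverse square roots\<close>

text \<open>The coefficients of (1 - x)^(-1/2).\<close>

definition isq_coeff :: "nat \<Rightarrow> real" where
  "isq_coeff n = (-1) ^ n * ((-1/2) gchoose n)"

lemma isq_coeff_0 [simp]: "isq_coeff 0 = 1"
  by (simp add: isq_coeff_def)

lemma isq_coeff_Suc: "isq_coeff (Suc n) = isq_coeff n * ((2 * real n + 1) / (2 * real n + 2))"
proof -
  have "(-1/2 gchoose Suc n) = (-1/2 gchoose n) * (- ((2 * real n + 1) / (2 * real n + 2)))"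
    by (simp add: gbinomial_prod_rev fact_Suc atLeast0_lessThan_Suc divide_simps)
      (simp add: algebra_simps)
  then show ?thesis
    by (simp add: isq_coeff_def)
qed

lemma isq_coeff_nonneg: "isq_coeff n \<ge> 0"
  by (induction n) (auto simp: isq_coeff_Suc)

lemma abs_gbinomial_minus_half: "\<bar>(-1/2 :: real) gchoose n\<bar> = isq_coeff n"
proof -
  have "\<bar>isq_coeff n\<bar> = \<bar>(-1/2 :: real) gchoose n\<bar>"
    by (simp add: isq_coeff_def abs_mult)
  then show ?thesis
    using isq_coeff_nonneg[of n] by simp
qed

lemma isq_coeff_le_1: "isq_coeff n \<le> 1"
proof (induction n)
  case (Suc n)
  have "isq_coeff n * ((2 * real n + 1) / (2 * real n + 2)) \<le> 1 * 1"
    by (intro mult_mono Suc isq_coeff_nonneg) auto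
  then show ?case unfolding isq_coeff_Suc by simp
qed simp

text \<open>A Wallis-type bound: passing from n to n + 1 multiplies the left side by
  (2n+1)(2n+3)/(2n+2)^2, which is at most 1.\<close>

lemma isq_coeff_bound: "isq_coeff n ^ 2 * (2 * real n + 1) \<le> 1"
proof (induction n)
  case (Suc n)
  have "isq_coeff (Suc n) ^ 2 * (2 * real (Suc n) + 1)
      = (isq_coeff n ^ 2 * (2 * real n + 1)) * ((2 * real n + 1) * (2 * real n + 3) / (2 * real n + 2) ^ 2)"
    unfolding isq_coeff_Suc power_mult_distrib power_divide by (simp add: algebra_simps power2_eq_square)
  also have "\<dots> \<le> 1 * 1"
  proof (rule mult_mono)
    have "(2 * real n + 1) * (2 * real n + 3) \<le> (2 * real n + 2) ^ 2"
      by (simp add: power2_eq_square algebra_simps)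
    then show "(2 * real n + 1) * (2 * real n + 3) / (2 * real n + 2) ^ 2 \<le> 1"
      by (simp add: divide_le_eq_1)
  qed (use Suc in simp_all)
  finally show ?case by simp
qed simp

text \<open>The difference has absolute value \<open>isq_coeff n / (2 * real n + 2)\<close>, and
  \<open>isq_coeff_bound\<close> contributes the remaining power -1/2. Up to the shift by one these
  are coefficients of (1 - x)^(1/2).\<close>

lemma isq_coeff_diff_bound:
  "\<bar>isq_coeff (Suc n) - isq_coeff n\<bar> \<le> 2 * (real n + 2) powr (-3/2)"
proof -
  have eq: "\<bar>isq_coeff (Suc n) - isq_coeff n\<bar> = isq_coeff n / (2 * real n + 2)"
    using isq_coeff_nonneg[of n] by (simp add: isq_coeff_Suc field_simps)
  have "(isq_coeff n / (2 * real n + 2)) ^ 2 * (real n + 2) ^ 3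
      = isq_coeff n ^ 2 * (2 * real n + 1) * ((real n + 2) ^ 3 / ((2 * real n + 1) * (2 * real n + 2) ^ 2))"
    by (simp add: power_divide add_pos_nonneg[THEN less_imp_neq, symmetric])
  also have "\<dots> \<le> 1 * 2"
  proof (rule mult_mono)
    \<comment> \<open>This polynomial is the right side minus the left side of the cubic inequality
      that follows.\<close>
    have "0 \<le> 20 * real n + 34 * (real n * real n) + 15 * (real n * real n * real n)"
      by simp
    then have "(real n + 2) ^ 3 \<le> 2 * ((2 * real n + 1) * (2 * real n + 2) ^ 2)"
      by (simp add: power2_eq_square power3_eq_cube algebra_simps)
    then show "(real n + 2) ^ 3 / ((2 * real n + 1) * (2 * real n + 2) ^ 2) \<le> 2"
      by (simp add: divide_le_eq)
  qed (use isq_coeff_bound[of n] in simp_all)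
  finally have "(isq_coeff n / (2 * real n + 2)) ^ 2 \<le> 2 / (real n + 2) ^ 3"
    by (simp add: field_simps)
  also have "\<dots> \<le> 4 / (real n + 2) ^ 3"
    by (simp add: divide_right_mono)
  also have "\<dots> = (2 * (real n + 2) powr (-3/2)) ^ 2"
  proof -
    have "(2 * (real n + 2) powr (-3/2)) ^ 2 = 4 * (real n + 2) powr (-3)"
      by (simp add: power_mult_distrib powr_power)
    also have "(real n + 2) powr (-3) = 1 / (real n + 2) ^ 3"
      by (simp add: powr_minus powr_numeral field_simps)
    finally show ?thesis by simp
  qed
  finally show ?thesis
    unfolding eq by (rule power2_le_imp_le) simp
qed

text \<open>The inverse square root of 1 - u, provided that u has no constant term.\<close>

definition isq_fps :: "real fps \<Rightarrow> real fps" where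
  "isq_fps u = fps_compose (fps_binomial (-1/2)) (-u)"

lemma isq_fps_square:
  assumes "u $ 0 = 0"
  shows "isq_fps u ^ 2 * (1 - u) = 1"
proof -
  have "fps_binomial (-1/2 :: real) ^ 2 * (1 + fps_X) = fps_binomial (-1) * fps_binomial 1"
    by (simp add: fps_binomial_power fps_binomial_1)
  also have "\<dots> = 1"
    by (simp flip: fps_binomial_add_mult)
  finally have "fps_compose (fps_binomial (-1/2 :: real) ^ 2 * (1 + fps_X)) (-u) = fps_compose 1 (-u)"
    by simp
  then show ?thesis using assms
    by (simp add: isq_fps_def fps_compose_mult_distrib fps_compose_power fps_compose_add_distrib)
qed

lemma isq_fps_nth: "isq_fps u $ n = (\<Sum>i=0..n. isq_coeff i * (u ^ i) $ n)"
proof -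
  have "(- u) ^ i $ n = (-1) ^ i * (u ^ i) $ n" for i
    by (cases "even i") (simp_all)
  then show ?thesis
    unfolding isq_fps_def fps_compose_nth fps_binomial_nth isq_coeff_def
    by (intro sum.cong) simp_all
qed

lemma isq_fps_nth_0: "u $ 0 = 0 \<Longrightarrow> isq_fps u $ 0 = 1"
  by (simp add: isq_fps_nth)

lemma isq_fps_linear_nth: "isq_fps (fps_const c * fps_X) $ n = isq_coeff n * c ^ n"
proof -
  have "isq_fps (fps_const c * fps_X) $ n
      = (\<Sum>i=0..n. if i = n then isq_coeff n * c ^ n else 0)"
    unfolding isq_fps_nth
    by (intro sum.cong) (auto simp: power_mult_distrib fps_const_power)
  then show ?thesis by simp
qed

lemma fps_power_nth_nonneg:
  fixes u :: "real fps"
  assumes "\<And>n. u $ n \<ge> 0"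
  shows "(u ^ i) $ n \<ge> 0"
  using assms
  by (induction i arbitrary: n) (auto simp: fps_mult_nth intro!: sum_nonneg)

text \<open>Powers of u have nonnegative coefficients and every \<open>isq_coeff\<close> lies in
  [0,1], so the series is dominated term by term by the geometric series in u.\<close>

lemma isq_fps_nth_bounds:
  assumes "u $ 0 = 0" "\<And>n. u $ n \<ge> 0"
  shows "isq_fps u $ n \<ge> 0" and "isq_fps u $ n \<le> inverse (1 - u) $ n"
proof -
  note nn = fps_power_nth_nonneg[OF assms(2)]
  show "isq_fps u $ n \<ge> 0"
    unfolding isq_fps_nth by (intro sum_nonneg mult_nonneg_nonneg isq_coeff_nonneg nn)
  have "inverse (1 - fps_X) = (Abs_fps (\<lambda>_. 1) :: real fps)"
    by (simp add: fps_inverse_idempotent flip: fps_inverse_gp')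
  moreover have "(inverse (1 - fps_X) :: real fps) oo u = inverse (1 - u)"
    using assms(1) by (simp add: fps_inverse_compose fps_compose_sub_distrib)
  ultimately have "inverse (1 - u) = Abs_fps (\<lambda>_. 1) oo u"
    by metis
  then have "inverse (1 - u) $ n = (\<Sum>i=0..n. (u ^ i) $ n)"
    by (simp add: fps_compose_nth)
  moreover have "isq_fps u $ n \<le> (\<Sum>i=0..n. 1 * (u ^ i) $ n)"
    unfolding isq_fps_nth by (intro sum_mono mult_right_mono isq_coeff_le_1 nn)
  ultimately show "isq_fps u $ n \<le> inverse (1 - u) $ n" by simp
qed


section \<open>Decay rates under convolution\<close>

lemma geometric_decay_tail:
  fixes f :: "real fps"
  assumes "0 < z" "ereal z < fps_conv_radius f"
  obtains M q where "0 < q" "q < 1" "\<And>n. \<bar>f $ n * z ^ n\<bar> \<le> M * q ^ n"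
proof -
  \<comment> \<open>At a radius r strictly between z and the radius of convergence the terms stay
    bounded, so at z they decay like (z/r)^n.\<close>
  obtain r where r: "ereal z < ereal r" "ereal r < fps_conv_radius f"
    using ereal_dense2[OF assms(2)] by blast
  have zr: "z < r" using r(1) by simp
  have "summable (\<lambda>n. f $ n * r ^ n)"
    using r zr assms(1) by (intro summable_fps) simp
  then have "Bseq (\<lambda>n. f $ n * r ^ n)"
    by (intro convergent_imp_Bseq summable_imp_convergent)
  then obtain M where M: "\<And>n. \<bar>f $ n * r ^ n\<bar> \<le> M"
    by (auto simp: Bseq_def)
  show ?thesis
  proof (rule that[of "z / r" M])
    fix n
    have "\<bar>f $ n * z ^ n\<bar> = \<bar>f $ n * r ^ n\<bar> * (z / r) ^ n"
      using zr assms(1) by (simp add: abs_mult power_divide)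
    also have "\<dots> \<le> M * (z / r) ^ n"
      using M zr assms(1) by (intro mult_right_mono) auto
    finally show "\<bar>f $ n * z ^ n\<bar> \<le> M * (z / r) ^ n" .
  qed (use zr assms(1) in auto)
qed

text \<open>The majorant (n+1)(n+2) q^n comes from differentiating the geometric series
  twice.\<close>

lemma summable_powr_times_geometric:
  fixes q :: real
  assumes "0 \<le> q" "q < 1"
  shows "summable (\<lambda>n. (real n + 1) powr (3/2) * q ^ n)"
proof (rule summable_comparison_test')
  have "summable (\<lambda>n. diffs (\<lambda>_. 1) n * x ^ n)" if "norm x < 1" for x :: real
    using that by (rule termdiff_converges) (auto intro: summable_geometric)
  then have "summable (\<lambda>n. diffs (diffs (\<lambda>_. 1)) n * q ^ n)"
    by (rule termdiff_converges[rotated]) (use assms in auto)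
  then show "summable (\<lambda>n. (real n + 1) * (real n + 2) * q ^ n)"
    by (simp add: diffs_def add_ac)
  show "norm ((real n + 1) powr (3/2) * q ^ n) \<le> (real n + 1) * (real n + 2) * q ^ n" for n
  proof -
    have "(real n + 1) powr (3/2) \<le> (real n + 1) powr 2"
      by (intro powr_mono) auto
    also have "\<dots> \<le> (real n + 1) * (real n + 2)"
      by (simp add: power2_eq_square mult_left_mono)
    finally show ?thesis
      using assms by (simp add: mult_right_mono)
  qed
qed

text \<open>Submultiplicativity of the weight (n + 1)^(3/2) makes convolution with a geometrically
  decaying sequence preserve the decay rate n^(-3/2).\<close>

lemma convolution_decay:
  fixes h v :: "nat \<Rightarrow> real"
  assumes h: "\<And>n. \<bar>h n\<bar> \<le> H * (real n + 1) powr (-3/2)"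
    and v: "\<And>n. \<bar>v n\<bar> \<le> M * q ^ n" and q: "0 < q" "q < 1"
  obtains C where "\<And>n. \<bar>\<Sum>i\<le>n. v i * h (n - i)\<bar> \<le> C * (real n + 1) powr (-3/2)"
proof -
  define s where "s = (\<Sum>n. (real n + 1) powr (3/2) * q ^ n)"
  have sm: "summable (\<lambda>n. (real n + 1) powr (3/2) * q ^ n)"
    by (rule summable_powr_times_geometric) (use q in auto)
  have "0 \<le> H" using h[of 0] by simp
  have "0 \<le> M" using v[of 0] by simp
  have "\<bar>\<Sum>i\<le>n. v i * h (n - i)\<bar> \<le> M * H * s * (real n + 1) powr (-3/2)" for n
  proof -
    have "\<bar>v i * h (n - i)\<bar>
        \<le> M * H * (real n + 1) powr (-3/2) * ((real i + 1) powr (3/2) * q ^ i)" if "i \<le> n" for i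
    proof -
      have "(real n + 1) powr (3/2) \<le> ((real (n - i) + 1) * (real i + 1)) powr (3/2)"
        using that by (intro powr_mono2) (auto simp: of_nat_diff algebra_simps mult_left_mono)
      then have "(real (n - i) + 1) powr (-3/2)
          \<le> (real n + 1) powr (-3/2) * (real i + 1) powr (3/2)"
        unfolding powr_mult minus_divide_left[symmetric] powr_minus
        by (simp add: field_simps)
      then have "\<bar>v i\<bar> * \<bar>h (n - i)\<bar>
          \<le> (M * q ^ i) * (H * ((real n + 1) powr (-3/2) * (real i + 1) powr (3/2)))"
        using \<open>0 \<le> H\<close> \<open>0 \<le> M\<close> q
        by (intro mult_mono v order_trans[OF h] mult_left_mono) auto
      then show ?thesis by (simp add: abs_mult mult_ac)
    qed
    then have "\<bar>\<Sum>i\<le>n. v i * h (n - i)\<bar>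
        \<le> (\<Sum>i\<le>n. M * H * (real n + 1) powr (-3/2) * ((real i + 1) powr (3/2) * q ^ i))"
      by (intro order_trans[OF sum_abs] sum_mono) auto
    also have "\<dots> = M * H * (real n + 1) powr (-3/2) * (\<Sum>i\<le>n. (real i + 1) powr (3/2) * q ^ i)"
      by (simp only: sum_distrib_left)
    also have "\<dots> \<le> M * H * (real n + 1) powr (-3/2) * s"
      unfolding s_def using \<open>0 \<le> H\<close> \<open>0 \<le> M\<close> q
      by (intro mult_left_mono sum_le_suminf sm) auto
    finally show ?thesis by (simp add: mult_ac)
  qed
  then show ?thesis by (rule that)
qed

text \<open>Subtracting from the series of e its value at 1 extracts a factor 1 - x, which turns
  the coefficients of (1 - x)^(-1/2) into those of (1 - x)^(1/2).\<close>

lemma isq_coeff_transfer: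
  fixes e :: "nat \<Rightarrow> real"
  assumes e: "\<And>n. \<bar>e n\<bar> \<le> M * q ^ n" and q: "0 < q" "q < 1"
  obtains C where "\<And>n. \<bar>(\<Sum>i\<le>n. e i * isq_coeff (n - i)) - suminf e * isq_coeff n\<bar>
    \<le> C * (real n + 1) powr (-3/2)"
proof -
  have sq: "summable (\<lambda>n. M * q ^ n)"
    using q by (intro summable_mult summable_geometric) auto
  have se: "summable e"
    by (rule summable_comparison_test'[OF sq]) (use e in auto)
  \<comment> \<open>\<open>K\<close> consists of the tails of the series of \<open>e\<close>, so
    that E(1) - E(x) = (1 - x) K(x); \<open>h\<close> lists the coefficients of (1 -
    x)^(1/2).\<close>
  define K where "K n = suminf e - (\<Sum>i\<le>n. e i)" for n
  define h where "h n = (if n = 0 then 1 else isq_coeff n - isq_coeff (n - 1))" for n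
  have K: "\<bar>K n\<bar> \<le> M / (1 - q) * q ^ n" for n
  proof -
    have "K n = (\<Sum>i. e (i + Suc n))"
      using suminf_minus_initial_segment[OF se, of "Suc n"] by (simp add: K_def lessThan_Suc_atMost)
    also have "\<bar>\<dots>\<bar> \<le> (\<Sum>i. M * q ^ n * q ^ i)"
    proof (rule order_trans[OF summable_rabs])
      have b: "\<bar>e (i + Suc n)\<bar> \<le> M * q ^ n * q ^ i" for i
      proof -
        have "0 \<le> M" using e[of 0] by simp
        have "\<bar>e (i + Suc n)\<bar> \<le> M * q ^ n * q ^ i * q"
          using e[of "i + Suc n"] by (simp add: power_add mult_ac)
        also have "\<dots> \<le> M * q ^ n * q ^ i"
          using q \<open>0 \<le> M\<close> by (simp add: mult_left_le)
        finally show ?thesis .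
      qed
      have s2: "summable (\<lambda>i. M * q ^ n * q ^ i)"
        using q by (intro summable_mult summable_geometric) auto
      show s1: "summable (\<lambda>i. \<bar>e (i + Suc n)\<bar>)"
        by (rule summable_comparison_test'[OF s2]) (use b in auto)
      show "(\<Sum>i. \<bar>e (i + Suc n)\<bar>) \<le> (\<Sum>i. M * q ^ n * q ^ i)"
        by (intro suminf_le b s1 s2)
    qed
    also have "\<dots> = M / (1 - q) * q ^ n"
      using q by (simp add: suminf_mult summable_geometric suminf_geometric)
    finally show ?thesis .
  qed
  have h: "\<bar>h n\<bar> \<le> 2 * (real n + 1) powr (-3/2)" for n
    using isq_coeff_diff_bound[of "n - 1"] by (cases n) (simp_all add: h_def add_ac)
  obtain C where C: "\<And>n. \<bar>\<Sum>i\<le>n. K i * h (n - i)\<bar> \<le> C * (real n + 1) powr (-3/2)"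
    by (rule convolution_decay[OF h K q]) (rule that)
  have fps: "Abs_fps e = fps_const (suminf e) - (1 - fps_X) * Abs_fps K"
  proof (rule fps_ext)
    fix n show "Abs_fps e $ n = (fps_const (suminf e) - (1 - fps_X) * Abs_fps K) $ n"
      by (cases n) (simp_all add: ring_distribs K_def)
  qed
  have fps2: "Abs_fps h = (1 - fps_X) * Abs_fps isq_coeff"
    by (rule fps_ext) (simp add: ring_distribs h_def)
  have "Abs_fps e * Abs_fps isq_coeff
      = fps_const (suminf e) * Abs_fps isq_coeff - Abs_fps K * Abs_fps h"
    unfolding fps fps2 by (simp add: algebra_simps)
  then have "(Abs_fps e * Abs_fps isq_coeff) $ n
      = suminf e * isq_coeff n - (Abs_fps K * Abs_fps h) $ n" for n
    by simp
  then have eq: "(\<Sum>i\<le>n. e i * isq_coeff (n - i)) - suminf e * isq_coeff n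
      = - (\<Sum>i\<le>n. K i * h (n - i))" for n
    by (simp add: fps_mult_nth atLeast0AtMost)
  show ?thesis
    using C by (intro that[of C]) (simp add: eq)
qed

section \<open>Generating functions of the diagonals\<close>

text \<open>A root of the cubic found by the intermediate value theorem competes for least modulus,
  hence |zeta| <= 3/10. This excludes the root 1, and zeta (3 + zeta + zeta^2) = 1 then forces the
  sign.\<close>

lemma zeta_bounds: "0 < zeta" "zeta \<le> 3/10" and zeta_cubic: "3 * zeta + zeta ^ 2 + zeta ^ 3 = 1"
proof -
  let ?P = "\<lambda>x. poly Q_poly (complex_of_real x) = 0 \<and>
     (\<forall>z. poly Q_poly z = 0 \<and> z \<noteq> complex_of_real x \<longrightarrow> cmod (complex_of_real x) < cmod z)"
  have P: "?P zeta"
    unfolding zeta_def by (rule theI'[OF zeta_well_defined])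
  have root_iff: "poly Q_poly (complex_of_real x) = 0 \<longleftrightarrow> x = 1 \<or> 3 * x + x ^ 2 + x ^ 3 = 1" for x
  proof -
    have "poly Q_poly (complex_of_real x) = of_real ((1 - x) * (1 - 3 * x - x ^ 2 - x ^ 3))"
      by (simp add: poly_Q_factored)
    then show ?thesis
      by (simp only: of_real_eq_0_iff mult_eq_0_iff) auto
  qed
  have "\<exists>x\<ge>29/100. x \<le> 3/10 \<and> 3 * x + x ^ 2 + x ^ 3 = (1::real)"
    by (rule IVT') (auto intro!: continuous_intros simp: power2_eq_square power3_eq_cube)
  then obtain r :: real where r: "r \<ge> 29/100" "r \<le> 3/10" "3 * r + r ^ 2 + r ^ 3 = 1"
    by blast
  have "zeta = r \<or> \<bar>zeta\<bar> < \<bar>r\<bar>"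
    using P root_iff[of r] r(3) by (metis norm_of_real of_real_eq_iff)
  then have b: "\<bar>zeta\<bar> \<le> 3/10"
    using r by auto
  then show "zeta \<le> 3/10" by simp
  show c: "3 * zeta + zeta ^ 2 + zeta ^ 3 = 1"
    using P root_iff[of zeta] b by auto
  have "zeta * (3 + zeta + zeta ^ 2) = 1"
    using c by (simp add: algebra_simps power2_eq_square power3_eq_cube)
  moreover have "3 + zeta + zeta ^ 2 > 0"
    using b zero_le_power2[of zeta] by linarith
  ultimately show "0 < zeta"
    using zero_less_mult_pos2[of zeta "3 + zeta + zeta ^ 2"] by simp
qed

abbreviation D_fps :: "real fps" where
  "D_fps \<equiv> 1 - 2 * fps_X - fps_X ^ 2"

abbreviation Q_fps :: "real fps" where
  "Q_fps \<equiv> 1 - 4 * fps_X + 2 * fps_X ^ 2 + fps_X ^ 4"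

text \<open>Chosen such that Q(w) = (1 - w / zeta) (1 - cofactor(w)).\<close>

definition cofactor_poly :: "real poly" where
  "cofactor_poly = [:0, 1 - zeta - zeta ^ 2, zeta ^ 2, zeta:]"

definition B_fps :: "real fps" where
  "B_fps = isq_fps (fps_of_poly cofactor_poly)"

text \<open>The series T is Q^(-1/2), and S below is Q^(1/2).\<close>

definition T_fps :: "real fps" where
  "T_fps = B_fps * isq_fps (fps_const (1 / zeta) * fps_X)"

definition S_fps :: "real fps" where
  "S_fps = Q_fps * T_fps"

text \<open>The power series root r of D r = w + w^2 r^2. In this rationalised form the denominator
  has constant term 2 and is invertible, whereas D - S would have to be divided by 2 w^2.\<close>

definition \<rho>_fps :: "real fps" where
  "\<rho>_fps = 2 * fps_X * inverse (D_fps + S_fps)"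



lemma fps_of_poly_Q: "fps_of_poly [:1, -4, 2, 0, 1:] = Q_fps"
  unfolding fps_of_poly_pCons fps_of_poly_0
  by (simp add: algebra_simps eval_nat_numeral numeral_fps_const del: fps_const_mult)

lemma fps_of_poly_D: "fps_of_poly [:1, -2, -1:] = D_fps"
  unfolding fps_of_poly_pCons fps_of_poly_0
  by (simp add: algebra_simps eval_nat_numeral numeral_fps_const del: fps_const_mult)

text \<open>Comparing coefficients reduces everything to 1/zeta = 3 + zeta + zeta^2.\<close>

lemma Q_fps_factored:
  "(1 - fps_of_poly cofactor_poly) * (1 - fps_const (1 / zeta) * fps_X) = Q_fps"
proof -
  have "(1 - cofactor_poly) * [:1, - (1 / zeta):] = [:1, -4, 2, 0, 1:]"
    using zeta_bounds zeta_cubic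
    by (simp add: cofactor_poly_def one_pCons field_simps power2_eq_square power3_eq_cube)
  then have "fps_of_poly ((1 - cofactor_poly) * [:1, - (1 / zeta):]) = Q_fps"
    by (metis fps_of_poly_Q)
  moreover have "fps_of_poly [:1, - (1 / zeta):] = 1 - fps_const (1 / zeta) * fps_X"
    unfolding fps_of_poly_pCons fps_of_poly_0 by (simp flip: fps_const_neg)
  ultimately show ?thesis
    by (simp only: fps_of_poly_mult fps_of_poly_diff fps_of_poly_1)
qed

lemma coeff_cofactor_poly_0: "coeff cofactor_poly 0 = 0"
  unfolding cofactor_poly_def by simp

lemma T_fps_square: "T_fps ^ 2 * Q_fps = 1"
proof -
  have "T_fps ^ 2 * Q_fps = (B_fps ^ 2 * (1 - fps_of_poly cofactor_poly)) *
      (isq_fps (fps_const (1 / zeta) * fps_X) ^ 2 * (1 - fps_const (1 / zeta) * fps_X))"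
    unfolding T_fps_def Q_fps_factored[symmetric] by (simp only: power_mult_distrib mult_ac)
  also have "\<dots> = 1"
    unfolding B_fps_def by (subst (1 2) isq_fps_square) (simp_all add: coeff_cofactor_poly_0)
  finally show ?thesis .
qed

lemma S_fps_T_fps: "S_fps * T_fps = 1"
  using T_fps_square by (simp add: S_fps_def power2_eq_square mult_ac)

lemma S_fps_square: "S_fps ^ 2 = Q_fps"
proof -
  have "S_fps ^ 2 = Q_fps * (T_fps ^ 2 * Q_fps)"
    unfolding S_fps_def by (simp only: power2_eq_square mult_ac)
  then show ?thesis by (simp only: T_fps_square mult_1_right)
qed

lemma S_fps_nth_0: "S_fps $ 0 = 1"
  unfolding S_fps_def T_fps_def B_fps_def
  by (simp add: isq_fps_nth_0 coeff_cofactor_poly_0)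

lemma \<rho>_fps: "(D_fps + S_fps) * \<rho>_fps = 2 * fps_X"
proof -
  have "inverse (D_fps + S_fps) * (D_fps + S_fps) = 1"
    by (rule inverse_mult_eq_1) (simp add: S_fps_nth_0)
  moreover have "(D_fps + S_fps) * \<rho>_fps = 2 * fps_X * (inverse (D_fps + S_fps) * (D_fps + S_fps))"
    unfolding \<rho>_fps_def by (simp only: mult_ac)
  ultimately show ?thesis by (simp only: mult_1_right)
qed

lemma D_fps_square: "D_fps ^ 2 - Q_fps = 4 * fps_X ^ 3"
proof -
  have "(1 - 2 * x - x ^ 2) ^ 2 - (1 - 4 * x + 2 * x ^ 2 + x ^ 4) = 4 * x ^ 3" for x :: "real fps"
    by algebra
  then show ?thesis .
qed

text \<open>Multiplied by D + S, both sides become D^2 - Q = 4 w^3; the factor can be cancelled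
  because its constant term is not 0.\<close>

lemma D_minus_S: "D_fps - S_fps = 2 * fps_X ^ 2 * \<rho>_fps"
proof -
  have "(d - s) * (d + s) = 2 * x ^ 2 * r * (d + s)"
    if "d ^ 2 - q = 4 * x ^ 3" "s ^ 2 = q" "(d + s) * r = 2 * x" for d s q r x :: "real fps"
  proof -
    have "(d - s) * (d + s) = d ^ 2 - s ^ 2" "4 * x ^ 3 = 2 * x ^ 2 * (2 * x)"
      by algebra+
    then show ?thesis
      unfolding that(2) that(1) that(3)[symmetric] by (simp only: mult_ac)
  qed
  note eq = this[OF D_fps_square S_fps_square \<rho>_fps]
  have "(D_fps + S_fps) $ 0 \<noteq> 0"
    by (simp add: S_fps_nth_0)
  then have ne: "D_fps + S_fps \<noteq> 0"
    by (metis fps_zero_nth)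
  show ?thesis
    by (rule mult_right_cancel[OF ne, THEN iffD1, OF eq])
qed

text \<open>Write 2 D as (D - S) + (D + S) and multiply by \<rho>.\<close>

lemma \<rho>_fps_quadratic: "D_fps * \<rho>_fps = fps_X + fps_X ^ 2 * \<rho>_fps ^ 2"
proof -
  have "2 * (d * r) = 2 * (x + x ^ 2 * r ^ 2)"
    if "d - s = 2 * x ^ 2 * r" "(d + s) * r = 2 * x" for d s r x :: "real fps"
    using that by algebra
  from this[OF D_minus_S \<rho>_fps] show ?thesis by (simp only: mult_cancel_left) simp
qed

text \<open>The diagonal shifted by one; the extra constant term on the main diagonal makes the
  formula for the generating function uniform in the offset k.\<close>

definition diag_fps :: "nat \<Rightarrow> real fps" where
  "diag_fps k = Abs_fps (\<lambda>n. case n of 0 \<Rightarrow> of_bool (k = 0) | Suc m \<Rightarrow> real (num_protocols (m + k) m))"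

text \<open>Symmetry merges the two neighbouring diagonals into 2 \<open>diag_fps 1\<close>, and 1 -
  w corrects the initial coefficients.\<close>

lemma diag_fps_0:
  "diag_fps 0 = fps_X * (2 * diag_fps 0 + fps_X * diag_fps 0 + 2 * (fps_X * diag_fps 1)) + (1 - fps_X)"
  (is "_ = ?r")
proof (rule fps_ext)
  fix n
  consider "n = 0" | "n = Suc 0" | "n = Suc (Suc 0)" | m where "n = Suc (Suc (Suc m))"
    by (metis not0_implies_Suc)
  then show "diag_fps 0 $ n = ?r $ n"
    by cases (simp_all add: diag_fps_def num_protocols_rec num_protocols_0_left
        num_protocols_commute[of m "Suc m" for m] numeral_fps_const)
qed

text \<open>The boundary value t(1,0) = 1 is supplied by the extra constant term of
  \<open>diag_fps 0\<close>, so no correction term remains.\<close>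

lemma diag_fps_Suc:
  "diag_fps (Suc k) = fps_X * (2 * diag_fps (Suc k) + fps_X * diag_fps (Suc k) + diag_fps k
     + fps_X * diag_fps (Suc (Suc k)))"
  (is "_ = ?r")
proof (rule fps_ext)
  fix n
  consider "n = 0" | "n = Suc 0" | "n = Suc (Suc 0)" | m where "n = Suc (Suc (Suc m))"
    by (metis not0_implies_Suc)
  then show "diag_fps (Suc k) $ n = ?r $ n"
    by cases (simp_all add: diag_fps_def num_protocols_rec num_protocols_0_right numeral_fps_const)
qed

text \<open>Every right side carries a factor w, so coefficient n of each series depends only on
  earlier coefficients; the induction on n treats all k at once.\<close>

lemma fps_system_unique:
  fixes h :: "nat \<Rightarrow> real fps"
  assumes "h 0 = fps_X * (2 * h 0 + fps_X * h 0 + 2 * (fps_X * h 1))"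
    and "\<And>k. h (Suc k) = fps_X * (2 * h (Suc k) + fps_X * h (Suc k) + h k + fps_X * h (Suc (Suc k)))"
  shows "h k = 0"
proof -
  have "h k $ n = 0" for n
  proof (induction n arbitrary: k rule: less_induct)
    case (less n)
    obtain g where g: "h k = fps_X * g"
      and g': "g = 2 * h 0 + fps_X * h 0 + 2 * (fps_X * h 1) \<or>
        (\<exists>k'. g = 2 * h (Suc k') + fps_X * h (Suc k') + h k' + fps_X * h (Suc (Suc k')))"
      using assms by (cases k) blast+
    show ?case
    proof (cases n)
      case 0
      then show ?thesis by (simp add: g)
    next
      case (Suc m)
      then show ?thesis
        using g' less[of m] less[of "m - 1"] by (auto simp: g numeral_fps_const)
    qed
  qed
  then show ?thesis by (simp add: fps_eq_iff)
qed

text \<open>The right side solves the same system: for k = 0 by D - 2 w^2 \<rho> = S and S T = 1,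
  for larger k by the quadratic equation of \<rho>. The difference solves the homogeneous system and
  vanishes.\<close>

lemma diag_fps_eq: "diag_fps k = \<rho>_fps ^ k * (1 - fps_X) * T_fps"
proof -
  define g where "g k = \<rho>_fps ^ k * (1 - fps_X) * T_fps" for k
  have "D_fps * g 0 - 2 * fps_X ^ 2 * g 1 = (1 - fps_X) * ((D_fps - 2 * fps_X ^ 2 * \<rho>_fps) * T_fps)"
    unfolding g_def by (simp add: algebra_simps)
  also have "D_fps - 2 * fps_X ^ 2 * \<rho>_fps = S_fps"
    by (simp flip: D_minus_S)
  finally have g0: "g 0 = fps_X * (2 * g 0 + fps_X * g 0 + 2 * (fps_X * g 1)) + (1 - fps_X)"
    by (simp add: S_fps_T_fps algebra_simps power2_eq_square)
  have "D_fps * g (Suc k) = (D_fps * \<rho>_fps) * \<rho>_fps ^ k * (1 - fps_X) * T_fps" for k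
    unfolding g_def by (simp add: mult_ac)
  also have "\<dots> k = fps_X * g k + fps_X ^ 2 * g (Suc (Suc k))" for k
    unfolding \<rho>_fps_quadratic g_def by (simp add: algebra_simps power2_eq_square)
  finally have gS: "g (Suc k) = fps_X * (2 * g (Suc k) + fps_X * g (Suc k) + g k + fps_X * g (Suc (Suc k)))" for k
    by (simp add: algebra_simps power2_eq_square)
  have "diag_fps k - g k = 0"
  proof (rule fps_system_unique[of "\<lambda>k. diag_fps k - g k"])
    show "diag_fps 0 - g 0 = fps_X * (2 * (diag_fps 0 - g 0) + fps_X * (diag_fps 0 - g 0)
        + 2 * (fps_X * (diag_fps 1 - g 1)))"
      by (subst diag_fps_0, subst g0) (simp add: algebra_simps)
    show "diag_fps (Suc k) - g (Suc k) = fps_X * (2 * (diag_fps (Suc k) - g (Suc k))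
        + fps_X * (diag_fps (Suc k) - g (Suc k)) + (diag_fps k - g k)
        + fps_X * (diag_fps (Suc (Suc k)) - g (Suc (Suc k))))" for k
      by (subst diag_fps_Suc, subst gS) (simp add: algebra_simps)
  qed
  then show ?thesis by (simp add: g_def)
qed

section \<open>The expansion at zeta\<close>

lemma cofactor_coeff_nonneg: "fps_of_poly cofactor_poly $ n \<ge> 0"
proof -
  have "zeta ^ 2 \<le> zeta * 1"
    unfolding power2_eq_square using zeta_bounds by (intro mult_left_mono) auto
  then have "1 - zeta - zeta ^ 2 \<ge> 0"
    using zeta_bounds by simp
  then show ?thesis
    unfolding cofactor_poly_def using zeta_bounds
    by (auto simp: coeff_pCons split: nat.split)
qed

text \<open>The coefficients of the cofactor sum to 1, so its geometric series has coefficients at most 1.\<close>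

lemma inverse_cofactor_le_1: "inverse (1 - fps_of_poly cofactor_poly) $ n \<le> 1"
proof -
  define V where "V = inverse (1 - fps_of_poly cofactor_poly)"
  let ?a = "1 - zeta - zeta ^ 2" and ?b = "zeta ^ 2" and ?c = "zeta"
  have U: "fps_of_poly cofactor_poly = fps_X * (fps_const ?a + fps_X * (fps_const ?b + fps_X * fps_const ?c))"
    unfolding cofactor_poly_def fps_of_poly_pCons fps_of_poly_0 by (simp add: algebra_simps)
  have "V * (1 - fps_of_poly cofactor_poly) = 1"
    unfolding V_def by (rule inverse_mult_eq_1) (simp add: coeff_cofactor_poly_0)
  then have "V = 1 + fps_of_poly cofactor_poly * V"
    by (simp add: algebra_simps)
  also have "\<dots> = 1 + fps_X * (fps_const ?a * V + fps_X * (fps_const ?b * V + fps_X * (fps_const ?c * V)))"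
    unfolding U by (simp add: algebra_simps)
  finally have V: "V = \<dots>" .
  have a: "?a \<ge> 0" "?b \<ge> 0" "?c \<ge> 0"
    using cofactor_coeff_nonneg[of 1] zeta_bounds unfolding cofactor_poly_def by auto
  have "V $ n \<le> 1"
  proof (induction n rule: less_induct)
    case (less n)
    show ?case
    proof (cases n)
      case 0
      then show ?thesis by (subst V) simp
    next
      case (Suc m)
      have b: "?b * (if m = 0 then 0 else V $ (m - 1)) \<le> ?b * 1"
        using less[of "m - 1"] Suc a by (intro mult_left_mono) auto
      have c: "?c * (if m \<le> 1 then 0 else V $ (m - 2)) \<le> ?c * 1"
        using less[of "m - 2"] Suc a by (intro mult_left_mono) auto
      have a': "?a * V $ m \<le> ?a * 1"
        using less[of m] Suc a by (intro mult_left_mono) auto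
      \<comment> \<open>A recurrence whose nonnegative weights sum to 1; the conditionals supply 0
        for coefficients of negative index.\<close>
      have "V $ n = ?a * V $ m + (?b * (if m = 0 then 0 else V $ (m - 1))
          + ?c * (if m \<le> 1 then 0 else V $ (m - 2)))"
        by (subst V) (auto simp: Suc numeral_2_eq_2)
      also have "\<dots> \<le> ?a * 1 + (?b * 1 + ?c * 1)"
        by (intro add_mono a' b c)
      finally show ?thesis by simp
    qed
  qed
  then show ?thesis by (simp add: V_def)
qed

lemma B_fps_nth: "B_fps $ n \<ge> 0" "B_fps $ n \<le> 1"
  unfolding B_fps_def
  using isq_fps_nth_bounds[of "fps_of_poly cofactor_poly" n] cofactor_coeff_nonneg
    inverse_cofactor_le_1[of n] coeff_cofactor_poly_0
  by (auto intro: order_trans)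

text \<open>Coefficients in [0,1] give convergence at 1/2, which exceeds 3/10.\<close>

lemma fps_conv_radius_B: "ereal zeta < fps_conv_radius B_fps"
proof -
  have "summable (\<lambda>n. B_fps $ n * (1/2) ^ n)"
  proof (rule summable_comparison_test')
    show "summable (\<lambda>n. (1/2 :: real) ^ n)"
      by (rule summable_geometric) simp
    show "norm (B_fps $ n * (1/2) ^ n) \<le> (1/2) ^ n" for n
      using B_fps_nth[of n] by (simp add: abs_mult mult_left_le_one_le)
  qed
  from conv_radius_geI[OF this] have "ereal (1/2) \<le> fps_conv_radius B_fps"
    by (simp add: fps_conv_radius_def)
  moreover have "ereal zeta < ereal (1/2)"
    using zeta_bounds by simp
  ultimately show ?thesis by (rule less_le_trans[rotated])
qed

text \<open>The square of the value is 1/(1 - u(zeta)), where u is the cofactor, and the cubic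
  relation turns 1 - u(zeta) into 4 zeta^2 (2 + zeta). Nonnegative coefficients select the positive
  root.\<close>

lemma eval_B_fps: "eval_fps B_fps zeta = 1 / (2 * zeta * sqrt (2 + zeta))"
proof -
  define \<beta> where "\<beta> = eval_fps B_fps zeta"
  have r: "norm zeta < fps_conv_radius B_fps"
    using fps_conv_radius_B zeta_bounds by simp
  have "eval_fps (B_fps ^ 2 * fps_of_poly (1 - cofactor_poly)) zeta = \<beta> ^ 2 * poly (1 - cofactor_poly) zeta"
    using r less_le_trans[OF r fps_conv_radius_power]
    by (subst eval_fps_mult) (simp_all add: eval_fps_power \<beta>_def)
  moreover have "B_fps ^ 2 * fps_of_poly (1 - cofactor_poly) = 1"
    unfolding B_fps_def fps_of_poly_diff fps_of_poly_1
    by (rule isq_fps_square) (simp add: coeff_cofactor_poly_0)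
  ultimately have "\<beta> ^ 2 * poly (1 - cofactor_poly) zeta = 1"
    by simp
  also have "poly (1 - cofactor_poly) zeta = 1 - zeta + zeta ^ 2 + zeta ^ 3 - 2 * zeta ^ 4"
    unfolding cofactor_poly_def by (simp add: algebra_simps eval_nat_numeral)
  also have "\<dots> = 4 * zeta ^ 2 * (2 + zeta)"
    using zeta_cubic by algebra
  also have "\<dots> = (2 * zeta * sqrt (2 + zeta)) ^ 2"
    using zeta_bounds by (simp add: power_mult_distrib)
  finally have "(\<beta> * (2 * zeta * sqrt (2 + zeta))) ^ 2 = 1 ^ 2"
    by (simp add: power_mult_distrib)
  moreover have "0 \<le> \<beta>"
    unfolding \<beta>_def eval_fps_def using zeta_bounds r
    by (intro suminf_nonneg summable_fps mult_nonneg_nonneg B_fps_nth) auto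
  ultimately have "\<beta> * (2 * zeta * sqrt (2 + zeta)) = 1"
    using zeta_bounds by (subst (asm) power2_eq_iff_nonneg) auto
  then show ?thesis
    using zeta_bounds unfolding \<beta>_def by (simp add: field_simps)
qed

text \<open>As Q(zeta) = 0, D^2 = 4 w^3 at zeta; the bounds on \<open>zeta\<close> fix the
  sign.\<close>

lemma poly_D_zeta: "poly [:1, -2, -1:] zeta = 2 * zeta powr (3/2)"
proof -
  have "zeta ^ 2 \<le> zeta * 1"
    unfolding power2_eq_square using zeta_bounds by (intro mult_left_mono) auto
  then have nonneg: "0 \<le> 1 - 2 * zeta - zeta ^ 2"
    using zeta_bounds by simp
  have "(1 - 2 * zeta - zeta ^ 2) ^ 2 = 4 * zeta ^ 3"
    using zeta_cubic by algebra
  also have "\<dots> = (2 * zeta powr (3/2)) ^ 2"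
    using zeta_bounds by (simp add: power_mult_distrib powr_power)
  finally have "1 - 2 * zeta - zeta ^ 2 = 2 * zeta powr (3/2)"
    using nonneg by (subst (asm) power2_eq_iff_nonneg) auto
  then show ?thesis
    by (simp add: algebra_simps power2_eq_square)
qed

text \<open>Reducing by S^2 = Q keeps the form p + S r. Each step replaces p by D p - Q r, and Q
  vanishes at zeta, so p(zeta) just gains a factor D(zeta).\<close>

lemma D_minus_S_power:
  obtains p r where "(D_fps - S_fps) ^ k = fps_of_poly p + S_fps * fps_of_poly r"
    and "poly p zeta = poly [:1, -2, -1:] zeta ^ k"
proof -
  have "\<exists>p r. (D_fps - S_fps) ^ k = fps_of_poly p + S_fps * fps_of_poly r
      \<and> poly p zeta = poly [:1, -2, -1:] zeta ^ k"
  proof (induction k)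
    case 0
    show ?case by (rule exI[of _ 1], rule exI[of _ 0]) simp
  next
    case (Suc k)
    then obtain p r where pr: "(D_fps - S_fps) ^ k = fps_of_poly p + S_fps * fps_of_poly r"
      "poly p zeta = poly [:1, -2, -1:] zeta ^ k" by blast
    have gen: "(d - s) * (p + s * r) = (d * p - q * r) + s * (d * r - p)" if "s ^ 2 = q"
      for d s p r q :: "real fps"
      unfolding that[symmetric] by (simp add: algebra_simps power2_eq_square)
    have "(D_fps - S_fps) ^ Suc k = fps_of_poly ([:1, -2, -1:] * p - [:1, -4, 2, 0, 1:] * r)
        + S_fps * fps_of_poly ([:1, -2, -1:] * r - p)"
      unfolding power_Suc pr(1) gen[OF S_fps_square]
      by (simp only: fps_of_poly_mult fps_of_poly_diff fps_of_poly_D fps_of_poly_Q)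
    moreover have "poly [:1, -4, 2, 0, 1:] zeta = 0"
    proof -
      have "1 - 4 * zeta + 2 * zeta ^ 2 + zeta ^ 4 = 0"
        using zeta_cubic by algebra
      then show ?thesis by (simp add: algebra_simps eval_nat_numeral)
    qed
    then have "poly ([:1, -2, -1:] * p - [:1, -4, 2, 0, 1:] * r) zeta = poly [:1, -2, -1:] zeta ^ Suc k"
      unfolding poly_diff poly_mult pr(2) by simp
    ultimately show ?case by blast
  qed
  then show ?thesis using that by blast
qed

text \<open>Multiplying \<open>diag_fps k\<close> by (2 w^2)^k turns \<rho>^k into (D - S)^k, and S
  T = 1 makes the r-part a polynomial. The index collects 2k from this factor and 1 from the shift
  in \<open>diag_fps\<close>.\<close>

lemma num_protocols_coeff:
  assumes "(D_fps - S_fps) ^ k = fps_of_poly p + S_fps * fps_of_poly r"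
  shows "2 ^ k * real (num_protocols (j + k) j)
    = (fps_of_poly ([:1, -1:] * p) * T_fps) $ (j + 2 * k + 1) + coeff ([:1, -1:] * r) (j + 2 * k + 1)"
proof -
  have X: "fps_of_poly [:1, -1:] = 1 - (fps_X :: real fps)"
    unfolding fps_of_poly_pCons fps_of_poly_0 by (simp flip: fps_const_neg)
  have "(2 * fps_X ^ 2) ^ k * diag_fps k = (2 * fps_X ^ 2 * \<rho>_fps) ^ k * ((1 - fps_X) * T_fps)"
    unfolding diag_fps_eq power_mult_distrib by (simp only: mult_ac)
  also have "\<dots> = (fps_of_poly p + S_fps * fps_of_poly r) * ((1 - fps_X) * T_fps)"
    by (simp only: D_minus_S[symmetric] assms)
  also have "\<dots> = fps_of_poly ([:1, -1:] * p) * T_fps + (S_fps * T_fps) * fps_of_poly ([:1, -1:] * r)"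
    unfolding fps_of_poly_mult X by (simp only: ring_distribs mult_ac)
  finally have "(2 * fps_X ^ 2) ^ k * diag_fps k
      = fps_of_poly ([:1, -1:] * p) * T_fps + fps_of_poly ([:1, -1:] * r)"
    by (simp only: S_fps_T_fps mult_1_left)
  moreover have "(2 * fps_X ^ 2) ^ k * diag_fps k = fps_const (2 ^ k) * (fps_X ^ (2 * k) * diag_fps k)"
    by (simp only: power_mult_distrib power_mult numeral_fps_const fps_const_power mult.assoc)
  moreover have "(fps_const (2 ^ k) * (fps_X ^ (2 * k) * diag_fps k)) $ (j + 2 * k + 1)
      = 2 ^ k * real (num_protocols (j + k) j)"
    by (simp add: fps_X_power_mult_nth diag_fps_def)
  ultimately show ?thesis
    by (metis fps_add_nth fps_of_poly_nth)
qed

lemma poly_coeff_decay: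
  fixes p :: "real poly"
  obtains C where "\<And>n. \<bar>coeff p n * z ^ n\<bar> \<le> C * (real n + 1) powr (-3/2)"
proof -
  have "eventually (\<lambda>n. coeff p n * z ^ n * (real n + 1) powr (3/2) = 0) sequentially"
    using eventually_gt_at_top[of "degree p"] by eventually_elim (simp add: coeff_eq_0)
  then have "(\<lambda>n. coeff p n * z ^ n * (real n + 1) powr (3/2)) \<longlonglongrightarrow> 0"
    by (rule tendsto_eventually)
  then have "Bseq (\<lambda>n. coeff p n * z ^ n * (real n + 1) powr (3/2))"
    by (intro convergent_imp_Bseq convergentI)
  then obtain C where C: "\<And>n. \<bar>coeff p n * z ^ n * (real n + 1) powr (3/2)\<bar> \<le> C"
    by (auto simp: Bseq_def)
  have "\<bar>coeff p n * z ^ n\<bar> \<le> C * (real n + 1) powr (-3/2)" for n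
    using C[of n] by (simp add: abs_mult powr_minus field_simps)
  then show ?thesis by (rule that)
qed

text \<open>Scaling coefficient n by zeta^n turns the singular factor of \<open>T_fps\<close> into
  (1 - x)^(-1/2). Then \<open>isq_coeff_transfer\<close> applies to the remaining factor, which
  converges beyond zeta, and the polynomial part joins the error.\<close>

lemma num_protocols_estimate:
  obtains C where "\<And>j. \<bar>2 ^ k * real (num_protocols (j + k) j) * zeta ^ (j + 2 * k + 1)
      - (1 - zeta) * (2 * zeta powr (3/2)) ^ k / (2 * zeta * sqrt (2 + zeta)) * isq_coeff (j + 2 * k + 1)\<bar>
    \<le> C * (real (j + 2 * k + 1) + 1) powr (-3/2)"
proof -
  obtain p r where pr: "(D_fps - S_fps) ^ k = fps_of_poly p + S_fps * fps_of_poly r"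
    "poly p zeta = poly [:1, -2, -1:] zeta ^ k"
    by (rule D_minus_S_power)
  define E where "E = fps_of_poly ([:1, -1:] * p) * B_fps"
  have "ereal zeta < min (fps_conv_radius (fps_of_poly ([:1, -1:] * p))) (fps_conv_radius B_fps)"
    using fps_conv_radius_B by simp
  then have "ereal zeta < fps_conv_radius E"
    unfolding E_def using fps_conv_radius_mult less_le_trans by blast
  then obtain M q where Mq: "0 < q" "q < 1" "\<And>n. \<bar>E $ n * zeta ^ n\<bar> \<le> M * q ^ n"
    using geometric_decay_tail[OF zeta_bounds(1)] by blast
  have "suminf (\<lambda>n. E $ n * zeta ^ n) = eval_fps E zeta"
    by (simp add: eval_fps_def)
  also have "\<dots> = (1 - zeta) * (2 * zeta powr (3/2)) ^ k / (2 * zeta * sqrt (2 + zeta))"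
    unfolding E_def using fps_conv_radius_B zeta_bounds
    by (subst eval_fps_mult)
      (simp_all del: mult_pCons_left add: eval_B_fps pr(2) poly_D_zeta[simplified])
  finally have c: "suminf (\<lambda>n. E $ n * zeta ^ n)
      = (1 - zeta) * (2 * zeta powr (3/2)) ^ k / (2 * zeta * sqrt (2 + zeta))" .
  obtain C where C: "\<And>n. \<bar>(\<Sum>i\<le>n. E $ i * zeta ^ i * isq_coeff (n - i))
      - suminf (\<lambda>n. E $ n * zeta ^ n) * isq_coeff n\<bar> \<le> C * (real n + 1) powr (-3/2)"
    by (rule isq_coeff_transfer[OF Mq(3,1,2)]) (rule that)
  obtain C' where C': "\<And>n. \<bar>coeff ([:1, -1:] * r) n * zeta ^ n\<bar> \<le> C' * (real n + 1) powr (-3/2)"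
    by (rule poly_coeff_decay[of "[:1, -1:] * r" zeta]) (rule that)
  have conv: "(fps_of_poly ([:1, -1:] * p) * T_fps) $ n * zeta ^ n
      = (\<Sum>i\<le>n. E $ i * zeta ^ i * isq_coeff (n - i))" for n
  proof -
    have "fps_of_poly ([:1, -1:] * p) * T_fps = E * isq_fps (fps_const (1 / zeta) * fps_X)"
      unfolding E_def T_fps_def by (simp only: mult.assoc)
    then have "(fps_of_poly ([:1, -1:] * p) * T_fps) $ n * zeta ^ n
        = (\<Sum>i\<le>n. E $ i * (isq_coeff (n - i) * (1 / zeta) ^ (n - i)) * zeta ^ n)"
      by (simp only: fps_mult_nth isq_fps_linear_nth sum_distrib_right atLeast0AtMost)
    also have "\<dots> = (\<Sum>i\<le>n. E $ i * zeta ^ i * isq_coeff (n - i))"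
    proof (rule sum.cong)
      fix i assume "i \<in> {..n}"
      then have "zeta ^ n = zeta ^ i * zeta ^ (n - i)"
        by (simp flip: power_add)
      then show "E $ i * (isq_coeff (n - i) * (1 / zeta) ^ (n - i)) * zeta ^ n
          = E $ i * zeta ^ i * isq_coeff (n - i)"
        using zeta_bounds by (simp add: power_divide)
    qed simp
    finally show ?thesis .
  qed
  show ?thesis
  proof (rule that[of "C + C'"])
    fix j
    let ?N = "j + 2 * k + 1"
    have "2 ^ k * real (num_protocols (j + k) j) * zeta ^ ?N
        = (\<Sum>i\<le>?N. E $ i * zeta ^ i * isq_coeff (?N - i)) + coeff ([:1, -1:] * r) ?N * zeta ^ ?N"
      unfolding num_protocols_coeff[OF pr(1)] conv[symmetric] by (rule distrib_right)
    then show "\<bar>2 ^ k * real (num_protocols (j + k) j) * zeta ^ ?N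
        - (1 - zeta) * (2 * zeta powr (3/2)) ^ k / (2 * zeta * sqrt (2 + zeta)) * isq_coeff ?N\<bar>
      \<le> (C + C') * (real ?N + 1) powr (-3/2)"
      using C[of ?N] C'[of ?N] unfolding c distrib_right by linarith
  qed
qed

section \<open>Constants and the two asymptotic statements\<close>

lemma C1_pos: "0 < C1"
  using zeta_bounds by (simp add: C1_def)

text \<open>The powers of \<open>zeta\<close> on the left combine to 3k/2 + 1, which is independent
  of j; the 3/2 per unit of k matches D(zeta) = 2 zeta^(3/2).\<close>

lemma main_term:
  "C1 * zeta powr (- (real (j + k) + real j) / 2) * (2 ^ k * zeta ^ (j + 2 * k + 1))
    = (1 - zeta) * (2 * zeta powr (3/2)) ^ k / (2 * zeta * sqrt (2 + zeta))"
proof -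
  have "zeta powr (- (real (j + k) + real j) / 2) * zeta ^ (j + 2 * k + 1)
      = zeta powr (- (real (j + k) + real j) / 2) * zeta powr real (j + 2 * k + 1)"
    using zeta_bounds by (simp only: powr_realpow)
  also have "\<dots> = zeta powr (- (real (j + k) + real j) / 2 + real (j + 2 * k + 1))"
    by (simp only: powr_add)
  also have "- (real (j + k) + real j) / 2 + real (j + 2 * k + 1) = real k * (3/2) + 1"
    by (simp add: field_simps)
  also have "zeta powr (real k * (3/2) + 1) = (zeta powr (3/2)) ^ k * zeta"
    using zeta_bounds by (simp add: powr_add powr_power mult.commute)
  finally have *: "zeta powr (- (real (j + k) + real j) / 2) * zeta ^ (j + 2 * k + 1)
      = (zeta powr (3/2)) ^ k * zeta" .
  have "C1 * zeta powr (- (real (j + k) + real j) / 2) * (2 ^ k * zeta ^ (j + 2 * k + 1))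
      = C1 * 2 ^ k * (zeta powr (- (real (j + k) + real j) / 2) * zeta ^ (j + 2 * k + 1))"
    by (simp only: mult_ac)
  also have "\<dots> = (1 - zeta) * (2 * zeta powr (3/2)) ^ k / (2 * zeta * sqrt (2 + zeta))"
    unfolding * C1_def using zeta_bounds
    by (simp add: power_mult_distrib field_simps power2_eq_square)
  finally show ?thesis .
qed

text \<open>The constant is 1/Gamma(1/2).\<close>

lemma isq_coeff_asymptotic: "(\<lambda>n. isq_coeff n * sqrt (real n)) \<longlonglongrightarrow> 1 / sqrt pi"
proof -
  have "(\<lambda>n. ((-1/2 :: real) gchoose n) / ((-1) ^ n / exp ((-1/2 + 1) * of_real (ln (real n)))))
      \<longlonglongrightarrow> inverse (Gamma (- (-1/2)))"
    by (rule gbinomial_asymptotic)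
  also have "inverse (Gamma (- (-1/2))) = 1 / sqrt pi"
    by (simp add: Gamma_one_half_real field_simps)
  finally show ?thesis
  proof (rule Lim_transform_eventually)
    show "\<forall>\<^sub>F n in sequentially. ((-1/2 :: real) gchoose n) / ((-1) ^ n / exp ((-1/2 + 1) * of_real (ln (real n))))
        = isq_coeff n * sqrt (real n)"
      using eventually_gt_at_top[of 0]
    proof eventually_elim
      case (elim n)
      have "exp ((-1/2 + 1) * of_real (ln (real n))) = sqrt (real n)"
        using elim by (simp add: powr_def flip: powr_half_sqrt)
      then show ?case
        by (cases "even n") (simp_all add: isq_coeff_def)
    qed
  qed
qed

theorem theorem7p1:
  fixes k :: nat
  shows "(\<exists>C. \<forall>i j. 1 \<le> j \<and> j \<le> i \<and> i - j = k \<longrightarrow>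
            \<bar>real (num_protocols i j)
               - C1 * \<bar>(-1/2 :: real) gchoose (2 * i - j + 1)\<bar> * zeta powr (- (real i + real j) / 2)\<bar>
            \<le> C * (zeta powr (- real j) * real j powr (-3/2)))
       \<and> (\<lambda>j. real (num_protocols (j + k) j)) \<sim>[at_top]
           (\<lambda>j. C2 * zeta powr (- (real (j + k) + real j) / 2)
                  / sqrt (2 * real (j + k) - real j + 1))"
proof -
  define c where "c = (1 - zeta) * (2 * zeta powr (3/2)) ^ k / (2 * zeta * sqrt (2 + zeta))"
  define P where "P j = zeta powr (- (real (j + k) + real j) / 2)" for j
  have c_pos: "c > 0"
    using zeta_bounds by (simp add: c_def)
  have P_pos: "P j > 0" for j
    using zeta_bounds by (simp add: P_def)
  have c_eq: "C1 * P j * (2 ^ k * zeta ^ (j + 2 * k + 1)) = c" for j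
    unfolding c_def P_def by (rule main_term)
  obtain C where C: "\<And>j. \<bar>2 ^ k * real (num_protocols (j + k) j) * zeta ^ (j + 2 * k + 1)
      - c * isq_coeff (j + 2 * k + 1)\<bar> \<le> C * (real (j + 2 * k + 1) + 1) powr (-3/2)"
    by (rule num_protocols_estimate[where k = k, folded c_def]) (rule that)
  have "0 \<le> C * (real (0 + 2 * k + 1) + 1) powr (-3/2)"
    using C[of 0] by (rule order_trans[OF abs_ge_zero])
  then have C_nonneg: "0 \<le> C"
    by (simp add: zero_le_mult_iff)
  have "\<bar>real (num_protocols (j + k) j) - C1 * isq_coeff (j + 2 * k + 1) * P j\<bar>
      \<le> C / (2 ^ k * zeta ^ (2 * k + 1)) * (zeta powr (- real j) * real j powr (-3/2))"
    if "1 \<le> j" for j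
  proof -
    let ?N = "j + 2 * k + 1"
    let ?w = "2 ^ k * zeta ^ ?N"
    have w_pos: "?w > 0" using zeta_bounds by simp
    have "\<bar>real (num_protocols (j + k) j) - C1 * isq_coeff ?N * P j\<bar> * ?w
        = \<bar>(real (num_protocols (j + k) j) - C1 * isq_coeff ?N * P j) * ?w\<bar>"
      unfolding abs_mult[of _ ?w] abs_of_pos[OF w_pos] ..
    also have "(real (num_protocols (j + k) j) - C1 * isq_coeff ?N * P j) * ?w
        = 2 ^ k * real (num_protocols (j + k) j) * zeta ^ ?N - c * isq_coeff ?N"
      unfolding c_eq[of j, symmetric] by (simp only: left_diff_distrib right_diff_distrib mult_ac)
    also have "\<bar>\<dots>\<bar> \<le> C * (real ?N + 1) powr (-3/2)"
      by (rule C)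
    \<comment> \<open>The exponent is negative, so lowering the base to j increases the bound;
      positivity of j matters here.\<close>
    also have "\<dots> \<le> C * real j powr (-3/2)"
      using that C_nonneg by (intro mult_left_mono powr_mono2') auto
    finally have "\<bar>real (num_protocols (j + k) j) - C1 * isq_coeff ?N * P j\<bar>
        \<le> C * real j powr (-3/2) / ?w"
      using w_pos by (simp only: pos_le_divide_eq)
    also have "\<dots> = C / (2 ^ k * zeta ^ (2 * k + 1)) * (zeta powr (- real j) * real j powr (-3/2))"
    proof -
      have "zeta powr (- real j) = 1 / zeta ^ j"
        using zeta_bounds by (simp add: powr_minus_divide powr_realpow)
      moreover have "zeta ^ ?N = zeta ^ j * zeta ^ (2 * k + 1)"
        by (simp only: add.assoc power_add)
      ultimately show ?thesis by (simp only: times_divide_times_eq mult_1_right mult_1_left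
            times_divide_eq_left times_divide_eq_right divide_divide_eq_left mult_ac)
    qed
    finally show ?thesis .
  qed
  note part_a = this
  have "(\<lambda>j. real (num_protocols (j + k) j)) \<sim>[at_top]
      (\<lambda>j. C2 * P j / sqrt (2 * real (j + k) - real j + 1))"
  proof (rule asymp_equivI')
    let ?N = "\<lambda>j. j + 2 * k + 1"
    \<comment> \<open>\<open>?m\<close> is the ratio \<open>?r\<close> with the count replaced by
      its main term from part a, since C1/C2 = sqrt pi.\<close>
    let ?m = "\<lambda>j. sqrt pi * (isq_coeff (?N j) * sqrt (real (?N j)))"
    let ?r = "\<lambda>j. real (num_protocols (j + k) j) / (C2 * P j / sqrt (2 * real (j + k) - real j + 1))"
    have N_inf: "filterlim ?N at_top sequentially"
      using filterlim_add_const_nat_at_top[of "2 * k + 1"] by (simp add: add_ac)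
    have "?m \<longlonglongrightarrow> sqrt pi * (1 / sqrt pi)"
      by (intro tendsto_mult_left filterlim_compose[OF isq_coeff_asymptotic N_inf])
    then have lim_m: "?m \<longlonglongrightarrow> 1"
      by simp
    have bound: "norm (?r j - ?m j) \<le> sqrt pi * C / c * (1 / real (Suc (?N j)))" for j
    proof -
      define t where "t = real (num_protocols (j + k) j)"
      define N where "N = real (?N j)"
      define w where "w = 2 ^ k * zeta ^ ?N j"
      have N: "2 * real (j + k) - real j + 1 = N" and N_pos: "N > 0"
        by (simp_all add: N_def)
      have w_pos: "w > 0" using zeta_bounds by (simp add: w_def)
      have cw: "c = C1 * P j * w"
        using c_eq[of j] by (simp add: w_def)
      have "?r j - ?m j = sqrt pi * sqrt N / c * (t * w - c * isq_coeff (?N j))"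
        unfolding N t_def[symmetric] N_def[symmetric] C2_def cw
        using C1_pos P_pos[of j] w_pos N_pos by (simp add: field_simps)
      also have "norm \<dots> = sqrt pi * sqrt N / c * \<bar>t * w - c * isq_coeff (?N j)\<bar>"
        using c_pos N_pos by (simp add: abs_mult)
      also have "\<dots> \<le> sqrt pi * sqrt N / c * (C * (N + 1) powr (-3/2))"
        using C[of j] c_pos N_pos by (intro mult_left_mono) (simp_all add: t_def w_def N_def mult_ac)
      \<comment> \<open>Raising N to N + 1 under the root lets the powers 1/2 and -3/2 combine to
        1/(N + 1).\<close>
      also have "\<dots> \<le> sqrt pi * sqrt (N + 1) / c * (C * (N + 1) powr (-3/2))"
        using c_pos N_pos C_nonneg by (intro mult_right_mono divide_right_mono mult_left_mono) auto
      also have "\<dots> = sqrt pi * C / c * ((N + 1) powr (1/2) * (N + 1) powr (-3/2))"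
        using N_pos by (simp add: powr_half_sqrt)
      also have "(N + 1) powr (1/2) * (N + 1) powr (-3/2) = 1 / (N + 1)"
      proof -
        have "(N + 1) powr (1/2) * (N + 1) powr (-3/2) = (N + 1) powr (1/2 + (-3/2))"
          by (simp only: powr_add)
        also have "\<dots> = (N + 1) powr (-1)"
          by simp
        also have "\<dots> = 1 / (N + 1)"
          using N_pos by (simp add: powr_minus_divide)
        finally show ?thesis .
      qed
      finally show ?thesis by (simp add: N_def add_ac)
    qed
    have "(\<lambda>j. sqrt pi * C / c * (1 / real (Suc (?N j)))) \<longlonglongrightarrow> sqrt pi * C / c * 0"
      by (intro tendsto_mult_left filterlim_compose[OF lim_1_over_n]
          filterlim_compose[OF filterlim_Suc N_inf])
    then have "(\<lambda>j. sqrt pi * C / c * (1 / real (Suc (?N j)))) \<longlonglongrightarrow> 0"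
      by simp
    then have "(\<lambda>j. ?r j - ?m j) \<longlonglongrightarrow> 0"
      by (rule Lim_null_comparison[rotated]) (intro always_eventually allI bound)
    from tendsto_add[OF this lim_m] show "?r \<longlonglongrightarrow> 1"
      by simp
  qed
  moreover have "\<forall>i j. 1 \<le> j \<and> j \<le> i \<and> i - j = k \<longrightarrow>
      \<bar>real (num_protocols i j)
         - C1 * \<bar>(-1/2 :: real) gchoose (2 * i - j + 1)\<bar> * zeta powr (- (real i + real j) / 2)\<bar>
      \<le> C / (2 ^ k * zeta ^ (2 * k + 1)) * (zeta powr (- real j) * real j powr (-3/2))"
  proof (intro allI impI, elim conjE)
    fix i j :: nat assume ij: "1 \<le> j" "j \<le> i" "i - j = k"
    then have i: "i = j + k" and N: "2 * i - j + 1 = j + 2 * k + 1"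
      by auto
    show "\<bar>real (num_protocols i j)
         - C1 * \<bar>(-1/2 :: real) gchoose (2 * i - j + 1)\<bar> * zeta powr (- (real i + real j) / 2)\<bar>
      \<le> C / (2 ^ k * zeta ^ (2 * k + 1)) * (zeta powr (- real j) * real j powr (-3/2))"
      using part_a[OF ij(1)] unfolding N abs_gbinomial_minus_half unfolding i P_def .
  qed
  ultimately show ?thesis
    unfolding P_def by blast
qed

end
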